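(* For $s=\sigma+it$ with $t>0$ and $\sigma<0$ such that $1<1-\sigma<t^{1/2}$, and for $t\to+\infty$, we have $$\mathcal{R}(s)=\chi(s)\,O\Bigl[\Bigl(\frac{t}{2\pi}\Bigr)^{\sigma/2}|\sigma|^{-1}\Bigr],\qquad t\to+\infty,$$ with an implied constant independent of $\sigma$.
   Context: Riemann's auxiliary function is the entire function $$\mathcal{R}(s)=\int_{0\swarrow1}\frac{x^{-s}e^{\pi i x^2}}{e^{\pi i x}-e^{-\pi i x}}\,dx,$$ where the path is a straight line of direction $e^{-3\pi i/4}$ (running from the upper right to the lower left) crossing the real axis at a point strictly between $0$ and $1$, and $x^{-s}=\exp(-s\log x)$ with the principal logarithm. $\chi(s)=\pi^{s-\frac12}\Gamma(\frac{1-s}{2})/\Gamma(\frac{s}{2})$, so that $\zeta(s)=\chi(s)\zeta(1-s)$. *)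

theory Defs
  imports "HOL-Complex_Analysis.Complex_Analysis"
begin

text \<open>The path is parametrised by \<open>u \<mapsto> c + u * exp (- 3 * pi * \<i> / 4)\<close> with \<open>u\<close>
  running over the whole real line; the trailing factor is the derivative of this parametrisation.
  For \<open>0 < c < 1\<close> the path avoids the integers and the cut of \<open>Ln\<close> (the principal
  logarithm), the integrand decays like a Gaussian, and by Cauchy's theorem the value does not
  depend on \<open>c\<close>. For real \<open>c\<close> outside that interval the definition has no significance.\<close>

definition auxR_integrand :: "complex \<Rightarrow> complex \<Rightarrow> complex" where
  "auxR_integrand s x =
     exp (- s * Ln x) * exp (of_real pi * \<i> * x ^ 2) /
       (exp (of_real pi * \<i> * x) - exp (- of_real pi * \<i> * x))"

definition auxR :: "real \<Rightarrow> complex \<Rightarrow> complex" where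
  "auxR c s =
     (\<integral>u. auxR_integrand s (of_real c + of_real u * cis (- 3 * pi / 4)) * cis (- 3 * pi / 4)
        \<partial>lborel)"

definition chi :: "complex \<Rightarrow> complex" where
  "chi s = of_real pi powr (s - 1 / 2) * Gamma ((1 - s) / 2) / Gamma (s / 2)"

end

theory Submission
  imports Defs "HOL-Probability.Distributions" "HOL-Real_Asymp.Real_Asymp"
begin

text \<open>Put \<open>a = sqrt (t / (2 * pi))\<close> and \<open>N = \<lfloor>a\<rfloor>\<close>. Moving the path across the poles \<open>1, \<dots>, N\<close> to the
  line through \<open>N + 1 / 2\<close> splits off the partial sum of \<open>n powr (- s)\<close>, which is at most
  \<open>a powr (- \<sigma>) + a powr (1 - \<sigma>) / (1 - \<sigma>)\<close>. The new line lies within \<open>1 / 2\<close> of the saddle point \<open>a\<close>;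
  there the integrand is dominated by \<open>a powr (- \<sigma>)\<close> times a fixed Gaussian, uniformly for
  \<open>- \<sigma> < sqrt t\<close>. Since \<open>- \<sigma> = O(a)\<close>, everything is \<open>O(a powr (1 - \<sigma>) / \<bar>\<sigma>\<bar>)\<close>. On the other side,
  \<open>Re (Digamma (x + \<i> * \<tau>)) \<ge> ln \<tau> - O(1 / \<tau>)\<close> for all real \<open>x\<close>; integrating this over
  \<open>\<sigma> / 2 \<le> x \<le> (1 - \<sigma>) / 2\<close> gives \<open>\<bar>\<chi>(s)\<bar> \<ge> c * a powr (1 - 2 * \<sigma>)\<close> in the same range.\<close>

section \<open>Lower bound for the functional equation factor\<close>

text \<open>The logarithm in \<open>H\<close> is a primitive of \<open>u / (u\<^sup>2 + \<tau>\<^sup>2)\<close>; the arctangent pays for the variation of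
  this function over a unit interval, at a total cost of only \<open>2 * pi / \<tau>\<close>.\<close>

lemma digamma_term_le_diff:
  fixes u \<tau> :: real
  assumes "\<tau> \<ge> 1"
  defines "H \<equiv> \<lambda>v. ln (v\<^sup>2 + \<tau>\<^sup>2) / 2 + 2 / \<tau> * arctan (v / \<tau>)"
  shows "u / (u\<^sup>2 + \<tau>\<^sup>2) \<le> H (u + 1) - H u"
proof -
  have pos: "v\<^sup>2 + \<tau>\<^sup>2 > 0" for v :: real
    using assms by (simp add: add_nonneg_pos)
  have der: "(H has_real_derivative (v + 2) / (v\<^sup>2 + \<tau>\<^sup>2)) (at v)" for v
    unfolding H_def using pos[of v] assms(1)
    by (auto intro!: derivative_eq_intros simp: divide_simps power2_eq_square) (simp add: algebra_simps)
  obtain v where v: "u < v" "v < u + 1" "H (u + 1) - H u = (v + 2) / (v\<^sup>2 + \<tau>\<^sup>2)"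
    using MVT2[of u "u + 1" H "\<lambda>v. (v + 2) / (v\<^sup>2 + \<tau>\<^sup>2)"] der by auto
  define h where "h = v - u"
  have h: "0 \<le> h" "h \<le> 1" "v = u + h" using v by (auto simp: h_def)
  have "1 \<le> \<tau>\<^sup>2" using assms by simp
  \<comment> \<open>The claim after cross-multiplication at \<open>v = u + h\<close>. The summand
    \<open>2\<close>, contributed by the arctangent, absorbs the loss
    \<open>h * (u\<^sup>2 + u * h)\<close>.\<close>
  have "(v + 2) * (u\<^sup>2 + \<tau>\<^sup>2) - u * (v\<^sup>2 + \<tau>\<^sup>2) = h * (\<tau>\<^sup>2 - u\<^sup>2 - u * h) + 2 * (u\<^sup>2 + \<tau>\<^sup>2)"
    unfolding h(3) by (simp add: algebra_simps power2_eq_square)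
  moreover have "h * (u\<^sup>2 + u * h) \<le> 2 * (u\<^sup>2 + \<tau>\<^sup>2)"
  proof -
    have "u * h \<le> u\<^sup>2 + 1"
      using h mult_left_mono[of h 1 "\<bar>u\<bar>"] abs_ge_self[of "u * h"] zero_le_power2[of "\<bar>u\<bar> - 1/2"]
      by (simp add: abs_mult power2_eq_square algebra_simps) 
    then have "u\<^sup>2 + u * h \<le> 2 * (u\<^sup>2 + \<tau>\<^sup>2)" using \<open>1 \<le> \<tau>\<^sup>2\<close> by simp
    then have "h * (u\<^sup>2 + u * h) \<le> h * (2 * (u\<^sup>2 + \<tau>\<^sup>2))" using h by (intro mult_left_mono) auto
    also have "\<dots> \<le> 1 * (2 * (u\<^sup>2 + \<tau>\<^sup>2))" using h by (intro mult_right_mono) auto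
    finally show ?thesis by simp
  qed
  moreover have "0 \<le> h * \<tau>\<^sup>2" using h by simp
  ultimately have "u * (v\<^sup>2 + \<tau>\<^sup>2) \<le> (v + 2) * (u\<^sup>2 + \<tau>\<^sup>2)"
    by (simp add: algebra_simps)
  then show ?thesis unfolding v(3) using pos[of u] pos[of v] by (simp add: divide_simps mult.commute)
qed

text \<open>\<open>digamma_term_le_diff\<close> telescopes in the limit formula for
  \<open>Digamma\<close>: the logarithm at the far end cancels \<open>ln m\<close>, the one at
  \<open>x\<close> is at least \<open>ln \<tau>\<close>, and the arctangents differ by at most
  \<open>pi\<close>. Negative \<open>x\<close> is covered, as the argument
  \<open>\<sigma> / 2\<close> of Gamma in \<open>chi\<close> demands.\<close>

lemma Re_Digamma_ge:
  fixes x \<tau> :: real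
  assumes "\<tau> \<ge> 1"
  shows "Re (Digamma (Complex x \<tau>)) \<ge> ln \<tau> - 2 * pi / \<tau>"
proof -
  define H where "H = (\<lambda>v. ln (v\<^sup>2 + \<tau>\<^sup>2) / 2 + 2 / \<tau> * arctan (v / \<tau>))"
  define D where "D = (\<lambda>m. ln (real m) - (\<Sum>n<m. (x + real n) / ((x + real n)\<^sup>2 + \<tau>\<^sup>2)))"
  define E where "E = (\<lambda>m. ln (real m) - ln ((x + real m)\<^sup>2 + \<tau>\<^sup>2) / 2 + ln \<tau> - 2 * pi / \<tau>)"
  have "Complex x \<tau> \<noteq> 0" using assms by (simp add: complex_eq_iff)
  from tendsto_Re[OF Digamma_LIMSEQ[OF this]]
  have lim: "D \<longlonglongrightarrow> Re (Digamma (Complex x \<tau>))"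
    by (simp add: D_def Re_divide inverse_eq_divide power2_eq_square)
  have "E m \<le> D m" for m
  proof -
    have "(\<Sum>n<m. (x + real n) / ((x + real n)\<^sup>2 + \<tau>\<^sup>2)) \<le> (\<Sum>n<m. H (x + real (Suc n)) - H (x + real n))"
    proof (intro sum_mono)
      fix n
      have "x + real (Suc n) = x + real n + 1" by simp
      then show "(x + real n) / ((x + real n)\<^sup>2 + \<tau>\<^sup>2) \<le> H (x + real (Suc n)) - H (x + real n)"
        unfolding H_def using digamma_term_le_diff[OF assms, of "x + real n"] by (simp only:)
    qed
    also have "\<dots> = H (x + real m) - H x"
      by (subst sum_lessThan_telescope) simp
    also have "\<dots> \<le> ln ((x + real m)\<^sup>2 + \<tau>\<^sup>2) / 2 - ln \<tau> + 2 * pi / \<tau>"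
    proof -
      have "ln \<tau> = ln (\<tau>\<^sup>2) / 2" using assms by (simp add: ln_realpow)
      also have "\<dots> \<le> ln (x\<^sup>2 + \<tau>\<^sup>2) / 2"
        using assms by (simp add: add_nonneg_pos)
      finally have 1: "ln \<tau> \<le> ln (x\<^sup>2 + \<tau>\<^sup>2) / 2" .
      have "arctan ((x + real m) / \<tau>) - arctan (x / \<tau>) \<le> pi"
        using arctan_ubound[of "(x + real m) / \<tau>"] arctan_lbound[of "x / \<tau>"] by simp
      then have "2 / \<tau> * (arctan ((x + real m) / \<tau>) - arctan (x / \<tau>)) \<le> 2 / \<tau> * pi"
        using assms by (intro mult_left_mono) auto
      with 1 show ?thesis unfolding H_def by (simp add: algebra_simps)
    qed
    finally show ?thesis by (simp add: D_def E_def)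
  qed
  moreover have "E \<longlonglongrightarrow> 0 + ln \<tau> - 2 * pi / \<tau>"
    unfolding E_def
  proof (intro tendsto_intros)
    \<comment> \<open>Taking \<open>m\<^sup>2\<close> out of the logarithm leaves the logarithm of a
      sequence tending to 1.\<close>
    show "(\<lambda>m. ln (real m) - ln ((x + real m)\<^sup>2 + \<tau>\<^sup>2) / 2) \<longlonglongrightarrow> 0"
    proof (rule Lim_transform_eventually)
      have "(\<lambda>m. (x * inverse (real m) + 1)\<^sup>2 + (\<tau> * inverse (real m))\<^sup>2) \<longlonglongrightarrow> (x * 0 + 1)\<^sup>2 + (\<tau> * 0)\<^sup>2"
        by (intro tendsto_intros lim_inverse_n)
      then have "(\<lambda>m. - (ln ((x * inverse (real m) + 1)\<^sup>2 + (\<tau> * inverse (real m))\<^sup>2) / 2)) \<longlonglongrightarrow> - (ln 1 / 2)"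
        by (intro tendsto_intros) auto
      then show "(\<lambda>m. - (ln ((x * inverse (real m) + 1)\<^sup>2 + (\<tau> * inverse (real m))\<^sup>2) / 2)) \<longlonglongrightarrow> 0"
        by simp
      show "\<forall>\<^sub>F m in sequentially. - (ln ((x * inverse (real m) + 1)\<^sup>2 + (\<tau> * inverse (real m))\<^sup>2) / 2) =
          ln (real m) - ln ((x + real m)\<^sup>2 + \<tau>\<^sup>2) / 2"
        using eventually_gt_at_top[of 0]
      proof eventually_elim
        case (elim m)
        have "(x * inverse (real m) + 1)\<^sup>2 + (\<tau> * inverse (real m))\<^sup>2 = ((x + real m)\<^sup>2 + \<tau>\<^sup>2) / (real m)\<^sup>2"
          using elim by (simp add: field_simps power2_eq_square)
        then show ?case
          using elim assms by (simp add: ln_div ln_realpow add_nonneg_pos diff_divide_distrib)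
      qed
    qed
  qed
  ultimately show ?thesis
    using tendsto_le[OF sequentially_bot lim, of E] by (simp add: eventually_sequentially)
qed

text \<open>Mean value theorem for \<open>ln (norm Gamma)\<close> along a horizontal segment, where
  the derivative is \<open>Re Digamma\<close>. The height \<open>\<tau> > 0\<close> keeps the
  segment off the cut of \<open>ln_Gamma\<close>, also to the left of the imaginary axis, so no
  reflection formula enters.\<close>

lemma norm_Gamma_ratio_ge:
  fixes x y \<tau> :: real
  assumes "\<tau> \<ge> 1" "x < y"
  shows "norm (Gamma (Complex y \<tau>)) \<ge> norm (Gamma (Complex x \<tau>)) * (\<tau> powr (y - x) * exp (- 2 * pi * (y - x) / \<tau>))"
proof -
  define g where "g = (\<lambda>u. Re (ln_Gamma (Complex u \<tau>)))"
  have norm_Gamma: "norm (Gamma (Complex u \<tau>)) = exp (g u)" for u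
  proof -
    have "Complex u \<tau> \<notin> \<int>\<^sub>\<le>\<^sub>0" using assms by (auto elim!: nonpos_Ints_cases simp: complex_eq_iff)
    then show ?thesis by (simp add: Gamma_complex_altdef g_def)
  qed
  have der: "(g has_real_derivative Re (Digamma (Complex u \<tau>))) (at u)" for u
  proof -
    have "Complex u \<tau> \<notin> \<real>\<^sub>\<le>\<^sub>0" using assms by (auto simp: complex_nonpos_Reals_iff)
    have "((\<lambda>u. ln_Gamma (of_real u + \<i> * of_real \<tau>)) has_vector_derivative Digamma (Complex u \<tau>)) (at u)"
      unfolding Complex_eq using \<open>Complex u \<tau> \<notin> \<real>\<^sub>\<le>\<^sub>0\<close>[unfolded Complex_eq]
      by (auto intro!: has_vector_derivative_real_field derivative_eq_intros)
    from bounded_linear.has_vector_derivative[OF bounded_linear_Re this] show ?thesis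
      unfolding g_def Complex_eq by (simp add: has_real_derivative_iff_has_vector_derivative)
  qed
  obtain z where "x < z" "z < y" "g y - g x = (y - x) * Re (Digamma (Complex z \<tau>))"
    using MVT2[of x y g "\<lambda>u. Re (Digamma (Complex u \<tau>))"] der assms by auto
  then have "g y - g x \<ge> (y - x) * (ln \<tau> - 2 * pi / \<tau>)"
    using Re_Digamma_ge[OF assms(1), of z] assms(2) by simp
  then have "exp (g y) \<ge> exp (g x + (y - x) * (ln \<tau> - 2 * pi / \<tau>))"
    by simp
  also have "exp (g x + (y - x) * (ln \<tau> - 2 * pi / \<tau>)) = exp (g x) * (\<tau> powr (y - x) * exp (- 2 * pi * (y - x) / \<tau>))"
    using assms(1) by (simp add: powr_def flip: exp_add) (simp add: algebra_simps)
  finally show ?thesis by (simp add: norm_Gamma)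
qed

lemma norm_chi_ge:
  fixes \<sigma> t :: real
  assumes "t \<ge> 2" "\<sigma> < 0" "1 - \<sigma> < sqrt t"
  shows "norm (chi (Complex \<sigma> t)) \<ge> exp (- 4 * pi) * (t / (2 * pi)) powr (1 / 2 - \<sigma>)"
proof -
  define s where "s = Complex \<sigma> t"
  define \<tau> where "\<tau> = t / 2"
  have \<tau>: "\<tau> \<ge> 1" using assms by (simp add: \<tau>_def)
  have "s / 2 = Complex (\<sigma> / 2) \<tau>" by (simp add: s_def \<tau>_def complex_eq_iff)
  \<comment> \<open>Conjugation preserves the modulus and brings both Gamma arguments to the same
    height \<open>\<tau>\<close>.\<close>
  moreover have "(1 - s) / 2 = cnj (Complex ((1 - \<sigma>) / 2) \<tau>)"
    by (simp add: s_def \<tau>_def complex_eq_iff)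
  ultimately have chi: "norm (chi s) = pi powr (\<sigma> - 1 / 2) * (norm (Gamma (Complex ((1 - \<sigma>) / 2) \<tau>)) / norm (Gamma (Complex (\<sigma> / 2) \<tau>)))"
    unfolding chi_def
    by (simp add: norm_mult norm_divide norm_powr_real_powr s_def flip: cnj_Gamma)
  have "Complex (\<sigma> / 2) \<tau> \<notin> \<int>\<^sub>\<le>\<^sub>0" using \<tau> by (auto elim!: nonpos_Ints_cases simp: complex_eq_iff)
  then have pos: "norm (Gamma (Complex (\<sigma> / 2) \<tau>)) > 0" by (simp add: Gamma_eq_zero_iff)
  have d: "(1 - \<sigma>) / 2 - \<sigma> / 2 = 1 / 2 - \<sigma>" by (simp add: field_simps)
  have "norm (Gamma (Complex ((1 - \<sigma>) / 2) \<tau>)) / norm (Gamma (Complex (\<sigma> / 2) \<tau>))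
      \<ge> \<tau> powr (1 / 2 - \<sigma>) * exp (- 2 * pi * (1 / 2 - \<sigma>) / \<tau>)"
    using norm_Gamma_ratio_ge[OF \<tau>, of "\<sigma> / 2" "(1 - \<sigma>) / 2"] assms(2) pos
    unfolding d by (simp add: field_simps)
  \<comment> \<open>The chain \<open>1 / 2 - \<sigma> < sqrt t \<le> t = 2 * \<tau>\<close> bounds
    the exponential loss uniformly in \<sigma>.\<close>
  moreover have "\<tau> powr (1 / 2 - \<sigma>) * exp (- 4 * pi) \<le> \<tau> powr (1 / 2 - \<sigma>) * exp (- 2 * pi * (1 / 2 - \<sigma>) / \<tau>)"
  proof -
    have "sqrt t * 1 \<le> sqrt t * sqrt t" using assms by (intro mult_left_mono) auto
    then have "1 / 2 - \<sigma> \<le> 2 * \<tau>" using assms by (simp add: \<tau>_def)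
    then have "pi * (1 / 2 - \<sigma>) \<le> pi * (2 * \<tau>)" by (intro mult_left_mono) auto
    then have "2 * pi * (1 / 2 - \<sigma>) / \<tau> \<le> 4 * pi"
      using \<tau> by (simp add: divide_simps algebra_simps)
    then show ?thesis by (intro mult_left_mono) auto
  qed
  ultimately have "norm (chi s) \<ge> pi powr (\<sigma> - 1 / 2) * (\<tau> powr (1 / 2 - \<sigma>) * exp (- 4 * pi))"
    unfolding chi by (intro mult_left_mono) auto
  also have "pi powr (\<sigma> - 1 / 2) = inverse (pi powr (1 / 2 - \<sigma>))"
    using powr_minus[of pi "1 / 2 - \<sigma>"] by (simp only: minus_diff_eq)
  also have "\<dots> * (\<tau> powr (1 / 2 - \<sigma>) * exp (- 4 * pi)) = exp (- 4 * pi) * (\<tau> / pi) powr (1 / 2 - \<sigma>)"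
    using \<tau> by (subst powr_divide) (auto simp: field_simps)
  finally show ?thesis by (simp add: s_def \<tau>_def)
qed

section \<open>Shifting vertical lines of integration\<close>

text \<open>Bridge from the gauge integrals that express contour integrals along segments to the
  Lebesgue integral in \<open>auxR\<close>, by dominated convergence with majorant
  \<open>norm (f y)\<close>.\<close>

lemma tendsto_integral_symmetric_interval:
  fixes f :: "real \<Rightarrow> complex"
  assumes "integrable lborel f"
  shows "(\<lambda>n. integral {- real n..real n} f) \<longlonglongrightarrow> (\<integral>y. f y \<partial>lborel)"
proof -
  have [measurable]: "f \<in> borel_measurable borel" using assms by auto
  have eq: "integral {- real n..real n} f = (\<integral>y. indicator {- real n..real n} y *\<^sub>R f y \<partial>lborel)" for n
  proof -
    have "set_integrable lborel {- real n..real n} f"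
      unfolding set_integrable_def using assms by (intro integrable_mult_indicator) auto
    from set_borel_integral_eq_integral(2)[OF this] show ?thesis
      by (simp add: set_lebesgue_integral_def)
  qed
  show ?thesis
    unfolding eq
  proof (rule integral_dominated_convergence[where w = "\<lambda>y. norm (f y)"])
    show "AE y in lborel. (\<lambda>n. indicator {- real n..real n} y *\<^sub>R f y) \<longlonglongrightarrow> f y"
    proof (rule AE_I2)
      fix y :: real
      obtain N :: nat where "\<bar>y\<bar> \<le> real N" using real_arch_simple by blast
      then have "\<forall>\<^sub>F n in sequentially. indicator {- real n..real n} y *\<^sub>R f y = f y"
        by (auto simp: eventually_sequentially indicator_def intro!: exI[of _ N])
      then show "(\<lambda>n. indicator {- real n..real n} y *\<^sub>R f y) \<longlonglongrightarrow> f y"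
        by (simp add: tendsto_eventually)
    qed
  qed (use assms in \<open>auto simp: indicator_def\<close>)
qed

text \<open>Continuity handles the compact middle part, about which the decay estimates say
  nothing.\<close>

lemma integrable_continuous_dominated_outside:
  fixes f :: "real \<Rightarrow> complex" and g :: "real \<Rightarrow> real"
  assumes f: "continuous_on UNIV f" and g: "integrable lborel g"
    and le: "\<And>y. \<bar>y\<bar> \<ge> V \<Longrightarrow> norm (f y) \<le> g y"
  shows "integrable lborel f"
proof -
  have [measurable]: "f \<in> borel_measurable borel"
    using f by (rule borel_measurable_continuous_onI)
  have 1: "set_integrable lborel {-V..V} f"
    using f continuous_on_subset by (intro borel_integrable_atLeastAtMost') blast
  have 2: "set_integrable lborel (- {-V..V}) f"
    unfolding set_integrable_def
  proof (rule Bochner_Integration.integrable_bound[OF g])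
    show "AE y in lborel. norm (indicator (- {-V..V}) y *\<^sub>R f y) \<le> norm (g y)"
    proof (rule AE_I2)
      fix y
      show "norm (indicator (- {-V..V}) y *\<^sub>R f y) \<le> norm (g y)"
      proof (cases "y \<in> {-V..V}")
        case False
        then have "norm (f y) \<le> g y" by (intro le) auto
        then show ?thesis using False by simp
      qed simp
    qed
  qed auto
  have "set_integrable lborel ({-V..V} \<union> - {-V..V}) f"
    using 1 2 by (intro set_integrable_Un) auto
  then show ?thesis by (simp add: set_integrable_def)
qed

text \<open>Residue theorem on rectangles between the two lines; a horizontal side at height
  \<open>L\<close> contributes at most \<open>B L * (b - a)\<close>. The factor is
  \<open>2 * pi\<close> without \<open>\<i>\<close> because the integrals are taken in
  \<open>y\<close>, with \<open>dz = \<i> dy\<close>. The wider strip from \<open>lo\<close> to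
  \<open>hi\<close> is an open convex set around the closed rectangles.\<close>

lemma vertical_line_integral_shift:
  fixes F :: "complex \<Rightarrow> complex" and a b lo hi V :: real and B :: "real \<Rightarrow> real"
  assumes ab: "lo < a" "a < b" "b < hi"
    and pts: "finite pts" "pts \<subseteq> {z. a < Re z \<and> Re z < b}"
    and holo: "F holomorphic_on {z. lo < Re z \<and> Re z < hi} - pts"
    and int: "integrable lborel (\<lambda>y. F (Complex a y))" "integrable lborel (\<lambda>y. F (Complex b y))"
    and decay: "(B \<longlongrightarrow> 0) at_top"
      "\<And>x y. a \<le> x \<Longrightarrow> x \<le> b \<Longrightarrow> V \<le> \<bar>y\<bar> \<Longrightarrow> norm (F (Complex x y)) \<le> B \<bar>y\<bar>"
  shows "(\<integral>y. F (Complex b y) \<partial>lborel) - (\<integral>y. F (Complex a y) \<partial>lborel) = 2 * pi * (\<Sum>p\<in>pts. residue F p)"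
proof -
  define S where "S = {z. lo < Re z \<and> Re z < hi}"
  define Ia where "Ia = (\<lambda>n. integral {- real n..real n} (\<lambda>y. F (Complex a y)))"
  define Ib where "Ib = (\<lambda>n. integral {- real n..real n} (\<lambda>y. F (Complex b y)))"
  define H where "H = (\<lambda>h. contour_integral (linepath (Complex a h) (Complex b h)) F)"
  have S: "open S" "convex S"
  proof -
    have S_eq: "S = {z. lo < Re z} \<inter> {z. Re z < hi}" by (auto simp: S_def)
    show "open S" unfolding S_eq by (intro open_Int open_halfspace_Re_gt open_halfspace_Re_lt)
    show "convex S" unfolding S_eq by (intro convex_Int convex_halfspace_Re_gt convex_halfspace_Re_lt)
  qed
  have opn: "open (S - pts)" using S pts by (simp add: open_Diff finite_imp_closed)
  have cont: "continuous_on (S - pts) F" using holo by (simp add: S_def holomorphic_on_imp_continuous_on)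
  \<comment> \<open>Every rectangle of half-height above \<open>M\<close> encloses all the poles and
    has none on its boundary.\<close>
  obtain M where M: "\<And>p. p \<in> pts \<Longrightarrow> \<bar>Im p\<bar> \<le> M"
    using finite_imp_bounded[of "Im ` pts"] pts(1) by (auto simp: bounded_iff)
  have main: "\<forall>\<^sub>F n in sequentially. Ib n - Ia n = 2 * pi * (\<Sum>p\<in>pts. residue F p) + \<i> * (H (- real n) - H (real n))"
  proof -
    obtain N :: nat where N: "max M 0 < real N" using reals_Archimedean2 by blast
    show ?thesis
    proof (rule eventually_sequentiallyI[of N])
      fix n assume "N \<le> n"
      define L where "L = real n"
      have L: "M < L" "0 < L" using N \<open>N \<le> n\<close> by (auto simp: L_def)
      define a1 a2 a3 a4 where "a1 = Complex a (- L)" and "a2 = Complex b (- L)"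
        and "a3 = Complex b L" and "a4 = Complex a L"
      let ?g = "rectpath a1 a3"
      have g_def: "?g = linepath a1 a2 +++ linepath a2 a3 +++ linepath a3 a4 +++ linepath a4 a1"
        by (simp add: rectpath_def Let_def a1_def a2_def a3_def a4_def)
      have sub: "path_image ?g \<subseteq> S - pts"
      proof
        fix z assume z: "z \<in> path_image ?g"
        then have "z \<in> cbox a1 a3 - box a1 a3"
          using ab L by (simp add: path_image_rectpath_cbox_minus_box a1_def a3_def)
        moreover have "z \<in> box a1 a3" if "z \<in> pts"
          using pts(2) M[OF that] L that by (auto simp: in_box_complex_iff a1_def a3_def)
        ultimately show "z \<in> S - pts"
          using ab by (auto simp: S_def in_cbox_complex_iff a1_def a3_def)
      qed
      have "contour_integral ?g F = 2 * pi * \<i> * (\<Sum>p\<in>pts. winding_number ?g p * residue F p)"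
      proof (rule Residue_theorem[OF S(1) _ pts(1)])
        show "connected S" using S by (simp add: convex_connected)
        show "F holomorphic_on S - pts" using holo by (simp add: S_def)
        show "\<forall>z. z \<notin> S \<longrightarrow> winding_number ?g z = 0"
        proof (intro allI impI)
          fix z assume "z \<notin> S"
          then show "winding_number ?g z = 0"
            using ab L by (intro winding_number_rectpath_outside)
              (auto simp: S_def in_cbox_complex_iff a1_def a3_def)
        qed
      qed (use sub in auto)
      also have "(\<Sum>p\<in>pts. winding_number ?g p * residue F p) = (\<Sum>p\<in>pts. residue F p)"
      proof (rule sum.cong[OF refl])
        fix p assume "p \<in> pts"
        then have "p \<in> box a1 a3"
          using pts(2) M[of p] L by (auto simp: in_box_complex_iff a1_def a3_def)
        then show "winding_number ?g p * residue F p = residue F p"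
          by (simp add: winding_number_rectpath)
      qed
      finally have res: "contour_integral ?g F = 2 * pi * \<i> * (\<Sum>p\<in>pts. residue F p)" .
      have segs: "closed_segment a1 a2 \<subseteq> S - pts" "closed_segment a2 a3 \<subseteq> S - pts"
        "closed_segment a3 a4 \<subseteq> S - pts" "closed_segment a4 a1 \<subseteq> S - pts"
        using sub unfolding g_def by (simp_all add: path_image_join)
      then have ci: "F contour_integrable_on linepath a1 a2" "F contour_integrable_on linepath a2 a3"
        "F contour_integrable_on linepath a3 a4" "F contour_integrable_on linepath a4 a1"
        by (auto intro!: contour_integrable_continuous_linepath continuous_on_subset[OF cont])
      have "contour_integral ?g F = contour_integral (linepath a1 a2) F + contour_integral (linepath a2 a3) F
          + contour_integral (linepath a3 a4) F + contour_integral (linepath a4 a1) F"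
        unfolding g_def using ci by (simp add: contour_integrable_join)
      also have "contour_integral (linepath a1 a2) F = H (- L)" by (simp add: H_def a1_def a2_def)
      also have "contour_integral (linepath a3 a4) F = - H L"
        unfolding H_def a3_def a4_def
        by (metis contour_integral_reverse_linepath a3_def a4_def segs(3) closed_segment_commute cont continuous_on_subset)
      also have "contour_integral (linepath a2 a3) F = \<i> * Ib n"
        unfolding Ib_def by (rule contour_integral_linepath_same_Re) (use L in \<open>auto simp: a2_def a3_def L_def\<close>)
      also have "contour_integral (linepath a4 a1) F = - contour_integral (linepath a1 a4) F"
        by (metis contour_integral_reverse_linepath segs(4) closed_segment_commute cont continuous_on_subset)
      also have "contour_integral (linepath a1 a4) F = \<i> * Ia n"
        unfolding Ia_def by (rule contour_integral_linepath_same_Re) (use L in \<open>auto simp: a1_def a4_def L_def\<close>)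
      finally have "\<i> * (Ib n - Ia n) = 2 * pi * \<i> * (\<Sum>p\<in>pts. residue F p) - (H (- L) - H L)"
        unfolding res by (simp add: algebra_simps)
      then have "- \<i> * (\<i> * (Ib n - Ia n)) = - \<i> * (2 * pi * \<i> * (\<Sum>p\<in>pts. residue F p) - (H (- L) - H L))"
        by (simp only:)
      then show "Ib n - Ia n = 2 * pi * (\<Sum>p\<in>pts. residue F p) + \<i> * (H (- real n) - H (real n))"
        by (simp add: algebra_simps L_def)
    qed
  qed
  \<comment> \<open>The sign \<epsilon> treats the upper and the lower horizontal side at
    once.\<close>
  have H_le: "\<forall>\<^sub>F n in sequentially. norm (H (\<epsilon> * real n)) \<le> B (real n) * (b - a)" if \<epsilon>: "\<bar>\<epsilon>\<bar> = 1" for \<epsilon>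
  proof -
    obtain N :: nat where N: "max (max M V) 0 < real N" using reals_Archimedean2 by blast
    show ?thesis
    proof (rule eventually_sequentiallyI[of N])
      fix n assume "N \<le> n"
      then have n: "M < real n" "V \<le> real n" using N by auto
      define h where "h = \<epsilon> * real n"
      have h: "\<bar>h\<bar> = real n" using \<epsilon> by (simp add: h_def abs_mult)
      have seg: "a \<le> Re z \<and> Re z \<le> b \<and> Im z = h" if "z \<in> closed_segment (Complex a h) (Complex b h)" for z
        using that ab by (auto simp: closed_segment_same_Im closed_segment_eq_real_ivl)
      have "closed_segment (Complex a h) (Complex b h) \<subseteq> S - pts"
        using seg M n h ab by (fastforce simp: S_def)
      then have "F contour_integrable_on linepath (Complex a h) (Complex b h)"
        by (auto intro!: contour_integrable_continuous_linepath continuous_on_subset[OF cont])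
      moreover have "norm (F z) \<le> B (real n)" if "z \<in> closed_segment (Complex a h) (Complex b h)" for z
      proof -
        have "z = Complex (Re z) h" using seg[OF that] by (simp add: complex_eq_iff)
        then show ?thesis using decay(2)[of "Re z" h] seg[OF that] h n by simp
      qed
      moreover have "0 \<le> B (real n)" using order_trans[OF norm_ge_zero decay(2)[of a h]] ab h n by simp
      ultimately have "norm (H h) \<le> B (real n) * norm (Complex b h - Complex a h)"
        unfolding H_def by (intro contour_integral_bound_linepath) auto
      also have "Complex b h - Complex a h = of_real (b - a)" by (simp add: complex_eq_iff)
      also have "norm (of_real (b - a) :: complex) = b - a" using ab by (simp only: norm_of_real)
      finally show "norm (H (\<epsilon> * real n)) \<le> B (real n) * (b - a)" by (simp only: h_def)
    qed
  qed
  have "(\<lambda>n. B (real n) * (b - a)) \<longlonglongrightarrow> 0 * (b - a)"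
    by (intro tendsto_intros filterlim_compose[OF decay(1) filterlim_real_sequentially])
  then have "(\<lambda>n. H (\<epsilon> * real n)) \<longlonglongrightarrow> 0" if "\<bar>\<epsilon>\<bar> = 1" for \<epsilon>
    using H_le[OF that] by (auto intro: Lim_null_comparison)
  from this[of 1] this[of "-1"] have "(\<lambda>n. H (real n)) \<longlonglongrightarrow> 0" "(\<lambda>n. H (- real n)) \<longlonglongrightarrow> 0"
    by simp_all
  then have "(\<lambda>n. 2 * pi * (\<Sum>p\<in>pts. residue F p) + \<i> * (H (- real n) - H (real n)))
      \<longlonglongrightarrow> 2 * pi * (\<Sum>p\<in>pts. residue F p) + \<i> * (0 - 0)"
    by (intro tendsto_intros)
  then have "(\<lambda>n. Ib n - Ia n) \<longlonglongrightarrow> 2 * pi * (\<Sum>p\<in>pts. residue F p)"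
    using main by (simp add: tendsto_cong)
  moreover have "(\<lambda>n. Ib n - Ia n) \<longlonglongrightarrow> (\<integral>y. F (Complex b y) \<partial>lborel) - (\<integral>y. F (Complex a y) \<partial>lborel)"
    unfolding Ia_def Ib_def by (intro tendsto_diff tendsto_integral_symmetric_interval int)
  ultimately show ?thesis using LIMSEQ_unique by blast
qed

section \<open>Size of the integrand\<close>

lemma norm_auxR_integrand:
  fixes x :: complex
  assumes "x \<noteq> 0"
  shows "norm (auxR_integrand (Complex \<sigma> t) x) =
    exp (- \<sigma> * ln (norm x) + t * Im (Ln x) - 2 * pi * (Re x * Im x)) /
      norm (exp (of_real pi * \<i> * x) - exp (- of_real pi * \<i> * x))"
proof -
  have "Im (x\<^sup>2) = 2 * (Re x * Im x)" by (simp add: power2_eq_square)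
  then have "Re (- Complex \<sigma> t * Ln x + of_real pi * \<i> * x\<^sup>2) =
      - \<sigma> * ln (norm x) + t * Im (Ln x) - 2 * pi * (Re x * Im x)"
    using assms by (simp add: algebra_simps)
  then show ?thesis
    unfolding auxR_integrand_def by (simp only: norm_divide norm_exp_eq_Re flip: exp_add)
qed

text \<open>The two exponentials have moduli \<open>exp (- pi * Im x)\<close> and
  \<open>exp (pi * Im x)\<close>, which are far apart away from the real axis; the reverse triangle
  inequality does the rest.\<close>

lemma norm_denominator_ge_1:
  fixes x :: complex
  assumes "\<bar>Im x\<bar> \<ge> 1"
  shows "norm (exp (of_real pi * \<i> * x) - exp (- of_real pi * \<i> * x)) \<ge> 1"
proof -
  define y where "y = \<bar>Im x\<bar>"
  have n: "norm (exp (of_real pi * \<i> * x)) = exp (- pi * Im x)" "norm (exp (- of_real pi * \<i> * x)) = exp (pi * Im x)"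
    by (simp_all add: norm_exp_eq_Re)
  have "\<bar>exp (- pi * Im x) - exp (pi * Im x)\<bar> = exp (pi * y) - exp (- pi * y)"
    by (cases "Im x \<ge> 0") (auto simp: y_def abs_if mult_less_0_iff zero_less_mult_iff)
  moreover have "pi * 1 \<le> pi * y" using assms by (intro mult_left_mono) (auto simp: y_def)
  then have "exp (pi * y) \<ge> 1 + 1" "exp (- pi * y) \<le> 1"
    using exp_ge_add_one_self[of "pi * y"] pi_ge_two by (linarith, simp add: y_def)
  ultimately have "\<bar>exp (- pi * Im x) - exp (pi * Im x)\<bar> \<ge> 1" by linarith
  also have "\<bar>exp (- pi * Im x) - exp (pi * Im x)\<bar> \<le> norm (exp (of_real pi * \<i> * x) - exp (- of_real pi * \<i> * x))"
    unfolding n[symmetric] by (rule norm_triangle_ineq3)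
  finally show ?thesis .
qed

text \<open>The denominator is \<open>2 * \<i> * sin (pi * x)\<close>. On this line the intercept
  \<open>N + 1 / 2\<close> shifts the angle \<open>2 * pi * Re x\<close> by \<open>pi\<close>, so
  the squared modulus becomes \<open>exp Y + exp (- Y) + 2 * cos Y\<close>, with the favourable sign
  at the real axis and independent of \<open>N\<close>.\<close>

lemma norm_denominator_half_integer_line_ge_1:
  fixes x :: complex and N :: nat
  assumes "Re x - Im x = real N + 1 / 2"
  shows "norm (exp (of_real pi * \<i> * x) - exp (- of_real pi * \<i> * x)) \<ge> 1"
proof -
  define Y where "Y = 2 * pi * Im x"
  have den: "exp (of_real pi * \<i> * x) - exp (- of_real pi * \<i> * x) = 2 * \<i> * sin (of_real pi * x)"
    by (simp add: sin_exp_eq mult_ac)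
  have "2 * (pi * Re x) = Y + pi + 2 * real N * pi"
    using arg_cong[OF assms, of "\<lambda>u. 2 * pi * u"] by (simp add: Y_def algebra_simps)
  then have "cos (2 * (pi * Re x)) = - cos Y"
    by (simp only: cos_add sin_add cos_2npi sin_2npi cos_pi sin_pi) simp
  moreover have "2 * Im (of_real pi * x) = Y" by (simp add: Y_def)
  ultimately have "norm (sin (of_real pi * x)) ^ 2 = (exp Y + exp (- Y) + 2 * cos Y) / 4"
    unfolding norm_sin_squared by (simp add: exp_minus)
  moreover have "exp Y + exp (- Y) + 2 * cos Y \<ge> 1"
  proof -
    define Z where "Z = \<bar>Y\<bar>"
    have Z: "0 \<le> Z" "exp Y + exp (- Y) = exp Z + exp (- Z)" "cos Y = cos Z"
      by (auto simp: Z_def abs_if)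
    have e: "exp Z \<ge> 1 + Z + Z\<^sup>2 / 2" "exp (- Z) \<ge> 1 - Z"
      using exp_lower_Taylor_quadratic[of Z] exp_ge_add_one_self[of "- Z"] Z by auto
    show ?thesis
    \<comment> \<open>For small \<open>Z\<close> the quadratic bounds give at least
      \<open>4 - Z\<^sup>2 / 2\<close>; for large \<open>Z\<close> already
      \<open>exp Z \<ge> 3\<close> outweighs \<open>2 * cos Z \<ge> - 2\<close>.\<close>
    proof (cases "Z \<le> 2")
      case True
      have "(sin (Z / 2))\<^sup>2 \<le> (Z / 2)\<^sup>2"
        by (rule iffD1[OF abs_le_square_iff abs_sin_x_le_abs_x])
      then have "cos Z \<ge> 1 - Z\<^sup>2 / 2"
        using cos_double_sin[of "Z / 2"] by (simp add: power_divide)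
      moreover have "Z\<^sup>2 \<le> 2\<^sup>2" using True Z by (intro power_mono) auto
      ultimately show ?thesis using e Z by simp
    next
      case False
      have "exp (- Z) > 0" by simp
      moreover have "exp Z \<ge> 3" using e(1) False zero_le_power2[of Z] by linarith
      ultimately show ?thesis using cos_ge_minus_one[of Z] unfolding Z by linarith
    qed
  qed
  ultimately have "norm (2 * \<i> * sin (of_real pi * x)) ^ 2 \<ge> 1"
    by (simp add: norm_mult power_mult_distrib)
  then show ?thesis
    unfolding den by (intro power2_le_imp_le[of 1]) simp_all
qed

section \<open>The argument of \<open>x\<close> along diagonal lines and the Gaussian bound near the
  saddle point\<close>

lemma has_real_derivative_Im_Ln_diagonal:
  fixes b w :: real
  assumes "b > 0"
  shows "((\<lambda>w. Im (Ln (Complex (b + w) w))) has_real_derivative b / ((b + w)\<^sup>2 + w\<^sup>2)) (at w)"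
proof -
  have nz: "Complex (b + w) w \<notin> \<real>\<^sub>\<le>\<^sub>0" using assms by (auto simp: complex_nonpos_Reals_iff)
  have eq: "Complex (b + w) w = of_real b + of_real w * (1 + \<i>)" for w
    by (simp add: complex_eq_iff)
  have "((\<lambda>w. Ln (of_real b + of_real w * (1 + \<i>))) has_vector_derivative (1 + \<i>) / Complex (b + w) w) (at w)"
    using nz unfolding eq
    by (auto intro!: has_vector_derivative_real_field derivative_eq_intros simp: field_simps)
  from bounded_linear.has_vector_derivative[OF bounded_linear_Im this]
  show ?thesis
    by (simp add: eq has_real_derivative_iff_has_vector_derivative Im_divide)
qed

text \<open>The argument vanishes at \<open>w = 0\<close>, and its derivative is at most
  \<open>2 / b\<close> because the line keeps distance \<open>b / sqrt 2\<close> from the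
  origin.\<close>

lemma abs_Im_Ln_diagonal_le:
  fixes b w :: real
  assumes "b > 0"
  shows "\<bar>Im (Ln (Complex (b + w) w))\<bar> \<le> 2 * \<bar>w\<bar> / b"
proof -
  have deriv_le: "\<bar>b / ((b + u)\<^sup>2 + u\<^sup>2)\<bar> \<le> 2 / b" for u
  proof -
    have "0 \<le> (b + 2 * u)\<^sup>2" by simp
    then have "b * b \<le> 2 * ((b + u)\<^sup>2 + u\<^sup>2)" by (simp add: power2_eq_square algebra_simps)
    moreover have "0 < (b + u)\<^sup>2 + u\<^sup>2" using assms by (auto simp: sum_power2_gt_zero_iff)
    ultimately show ?thesis using assms by (simp add: divide_simps)
  qed
  have "norm (Im (Ln (Complex (b + w) w)) - Im (Ln (Complex (b + 0) 0))) \<le> 2 / b * norm (w - 0)"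
    using has_real_derivative_Im_Ln_diagonal[OF assms] deriv_le
    by (intro field_differentiable_bound[of UNIV]) auto
  moreover have "Im (Ln (Complex b 0)) = 0" using assms by (simp add: Complex_eq)
  ultimately show ?thesis by simp
qed

text \<open>The modulus of \<open>x powr (- \<i> * t) * exp (pi * \<i> * x\<^sup>2)\<close> has logarithm
  \<open>2 * pi * (a\<^sup>2 * Im (Ln x) - Re x * Im x)\<close> with \<open>t = 2 * pi * a\<^sup>2\<close>; here the line passes exactly
  through the saddle point, \<open>a = b\<close>.\<close>

lemma saddle_point_phase_le:
  fixes b w :: real
  assumes "b > 0"
  shows "b\<^sup>2 * Im (Ln (Complex (b + w) w)) - (b + w) * w \<le> - w\<^sup>2 / 2"
proof -
  define E where "E = (\<lambda>w. b\<^sup>2 * Im (Ln (Complex (b + w) w)) - (b + w) * w + w\<^sup>2 / 2)"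
  define E' where "E' = (\<lambda>w. - (w * (3 * b\<^sup>2 + 4 * b * w + 2 * w\<^sup>2) / ((b + w)\<^sup>2 + w\<^sup>2)))"
  have der: "(E has_real_derivative E' u) (at u)" for u
  proof -
    have "0 < (b + u)\<^sup>2 + u\<^sup>2" using assms by (auto simp: sum_power2_gt_zero_iff)
    then have "b\<^sup>2 * (b / ((b + u)\<^sup>2 + u\<^sup>2)) - (b + 2 * u) + u = E' u"
      unfolding E'_def by (simp add: divide_simps) (simp add: algebra_simps power2_eq_square)
    moreover have "(E has_real_derivative b\<^sup>2 * (b / ((b + u)\<^sup>2 + u\<^sup>2)) - (b + 2 * u) + u) (at u)"
      unfolding E_def
      by (rule derivative_eq_intros has_real_derivative_Im_Ln_diagonal assms refl | simp)+
    ultimately show ?thesis by simp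
  qed
  have sign: "u * E' u \<le> 0" for u
  proof -
    \<comment> \<open>This is the quadratic factor of \<open>E'\<close>. Its positivity gives
      \<open>E'\<close> the sign opposite to \<open>u\<close>, so \<open>E\<close> is largest at
      0.\<close>
    have "0 \<le> 2 * (b + u)\<^sup>2 + b\<^sup>2" by simp
    then have "0 \<le> 3 * b\<^sup>2 + 4 * b * u + 2 * u\<^sup>2" by (simp add: power2_eq_square algebra_simps)
    then have "0 \<le> u * u * (3 * b\<^sup>2 + 4 * b * u + 2 * u\<^sup>2) / ((b + u)\<^sup>2 + u\<^sup>2)"
      by (intro divide_nonneg_nonneg mult_nonneg_nonneg[of "u * u"]) auto
    then show ?thesis by (simp add: E'_def mult.assoc)
  qed
  have E0: "E 0 = 0" using assms by (simp add: E_def Complex_eq)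
  have "E w \<le> 0"
  proof (cases w "0 :: real" rule: linorder_cases)
    case less
    then obtain z where "w < z" "z < 0" "E 0 - E w = (0 - w) * E' z"
      using MVT2[of w 0 E E'] der by auto
    then show ?thesis using sign[of z] less E0 by (simp add: mult_le_0_iff zero_le_mult_iff)
  next
    case greater
    then obtain z where "0 < z" "z < w" "E w - E 0 = (w - 0) * E' z"
      using MVT2[of 0 w E E'] der by auto
    then show ?thesis using sign[of z] greater E0 by (simp add: mult_le_0_iff zero_le_mult_iff)
  qed (simp add: E0)
  then show ?thesis by (simp add: E_def)
qed

text \<open>Both the growth of \<open>norm x powr (- \<sigma>)\<close> and the offset of the line
  from the saddle point cost only a multiple of \<open>\<bar>w\<bar>\<close> in the exponent,
  uniformly in \<sigma> and \<open>a\<close>; the quadratic decay of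
  \<open>saddle_point_phase_le\<close> absorbs them.\<close>

lemma norm_auxR_integrand_half_integer_line_le:
  fixes \<sigma> t a w :: real and N :: nat
  assumes a: "a \<ge> 1" "t = 2 * pi * a\<^sup>2" and \<sigma>: "0 < - \<sigma>" "- \<sigma> \<le> 3 * a" and N: "N = nat \<lfloor>a\<rfloor>"
  defines "b \<equiv> real N + 1 / 2"
  shows "norm (auxR_integrand (Complex \<sigma> t) (Complex (b + w) w)) \<le> a powr (- \<sigma>) * exp (227 - w\<^sup>2)"
proof -
  define x where "x = Complex (b + w) w"
  have "real N \<le> a" "a < real N + 1" using a(1) N by linarith+
  moreover have "1 \<le> N" using a(1) N by linarith
  ultimately have b: "\<bar>a - b\<bar> \<le> 1 / 2" "1 \<le> b"
    using a(1) unfolding b_def by linarith+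
  have "x \<noteq> 0" using b by (auto simp: x_def complex_eq_iff)
  have den: "norm (exp (of_real pi * \<i> * x) - exp (- of_real pi * \<i> * x)) \<ge> 1"
    by (rule norm_denominator_half_integer_line_ge_1[where N = N]) (simp add: x_def b_def)
  have "norm x \<le> \<bar>b + w\<bar> + \<bar>w\<bar>" unfolding x_def by (metis cmod_le complex.sel)
  also have "\<dots> \<le> a + (1 / 2 + 2 * \<bar>w\<bar>)" using b by linarith
  \<comment> \<open>Factoring out \<open>a\<close> and using \<open>1 + v \<le> exp v\<close>
    isolates \<open>ln a\<close>; the remainder is divided by \<open>a\<close>, which offsets the
    factor \<open>- \<sigma> \<le> 3 * a\<close>.\<close>
  also have "\<dots> = a * (1 + (1 / 2 + 2 * \<bar>w\<bar>) / a)" using a by (simp add: field_simps)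
  also have "\<dots> \<le> a * exp ((1 / 2 + 2 * \<bar>w\<bar>) / a)" using a by (intro mult_left_mono exp_ge_add_one_self) auto
  finally have "ln (norm x) \<le> ln (a * exp ((1 / 2 + 2 * \<bar>w\<bar>) / a))"
    using \<open>x \<noteq> 0\<close> a by (subst ln_le_cancel_iff) auto
  also have "\<dots> = ln a + (1 / 2 + 2 * \<bar>w\<bar>) / a" using a by (simp add: ln_mult)
  finally have "- \<sigma> * ln (norm x) \<le> - \<sigma> * (ln a + (1 / 2 + 2 * \<bar>w\<bar>) / a)"
    using \<sigma> by (intro mult_left_mono) auto
  also have "\<dots> = - \<sigma> * ln a + (- \<sigma> / a) * (1 / 2 + 2 * \<bar>w\<bar>)" by (simp add: algebra_simps add_divide_distrib diff_divide_distrib)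
  also have "(- \<sigma> / a) * (1 / 2 + 2 * \<bar>w\<bar>) \<le> 3 * (1 / 2 + 2 * \<bar>w\<bar>)"
    using \<sigma> a by (intro mult_right_mono) (auto simp: divide_simps)
  finally have 1: "- \<sigma> * ln (norm x) \<le> - \<sigma> * ln a + 2 + 6 * \<bar>w\<bar>" by simp
  have "\<bar>a + b\<bar> \<le> 3 * b" using a(1) b by linarith
  \<comment> \<open>The phase carries \<open>a\<^sup>2\<close> but the line passes through
    \<open>b\<close>. The difference is of order \<open>b\<close>, and the bound
    \<open>2 * \<bar>w\<bar> / b\<close> on the argument compensates for it.\<close>
  have "(a\<^sup>2 - b\<^sup>2) * Im (Ln x) \<le> \<bar>(a\<^sup>2 - b\<^sup>2) * Im (Ln x)\<bar>" by simp
  also have "\<dots> = \<bar>a - b\<bar> * \<bar>a + b\<bar> * \<bar>Im (Ln x)\<bar>"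
    by (simp add: abs_mult power2_eq_square square_diff_square_factored mult_ac)
  also have "\<dots> \<le> 1 / 2 * (3 * b) * (2 * \<bar>w\<bar> / b)"
    using b \<open>\<bar>a + b\<bar> \<le> 3 * b\<close> abs_Im_Ln_diagonal_le[of b w]
    by (intro mult_mono) (simp_all add: x_def)
  also have "\<dots> = 3 * \<bar>w\<bar>" using b by simp
  finally have "a\<^sup>2 * Im (Ln x) - (b + w) * w \<le> 3 * \<bar>w\<bar> - w\<^sup>2 / 2"
    using saddle_point_phase_le[of b w] b by (simp add: x_def algebra_simps)
  then have "2 * pi * (a\<^sup>2 * Im (Ln x) - (b + w) * w) \<le> 2 * pi * (3 * \<bar>w\<bar> - w\<^sup>2 / 2)"
    by (intro mult_left_mono) auto
  also have "\<dots> = 6 * (pi * \<bar>w\<bar>) - pi * w\<^sup>2" by (simp add: algebra_simps)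
  also have "\<dots> \<le> 6 * (4 * \<bar>w\<bar>) - 3 * w\<^sup>2"
    using pi_gt3 pi_less_4 by (intro diff_mono mult_left_mono mult_right_mono) auto
  finally have 2: "t * Im (Ln x) - 2 * pi * ((b + w) * w) \<le> 24 * \<bar>w\<bar> - 3 * w\<^sup>2"
    by (simp add: a(2) algebra_simps)
  \<comment> \<open>The linear terms \<open>6 * \<bar>w\<bar>\<close> and
    \<open>24 * \<bar>w\<bar>\<close> make \<open>30 * \<bar>w\<bar>\<close>; completing the square
    costs 225, and \<open>2 + 225 = 227\<close>.\<close>
  have "0 \<le> (\<bar>w\<bar> - 15)\<^sup>2" by simp
  then have "30 * \<bar>w\<bar> \<le> w\<^sup>2 + 225" by (simp add: power2_eq_square algebra_simps)
  moreover have ReIm: "Re x * Im x = (b + w) * w" by (simp add: x_def)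
  ultimately have "- \<sigma> * ln (norm x) + t * Im (Ln x) - 2 * pi * (Re x * Im x) \<le> - \<sigma> * ln a + (227 - w\<^sup>2)"
    using 1 2 zero_le_power2[of w] unfolding ReIm by linarith
  then have "exp (- \<sigma> * ln (norm x) + t * Im (Ln x) - 2 * pi * (Re x * Im x)) / norm (exp (of_real pi * \<i> * x) - exp (- of_real pi * \<i> * x))
      \<le> exp (- \<sigma> * ln a + (227 - w\<^sup>2)) / 1"
    using den by (intro frac_le) auto
  also have "\<dots> = a powr (- \<sigma>) * exp (227 - w\<^sup>2)" using a by (simp only: exp_add div_by_1) (simp add: powr_def)
  finally show ?thesis using norm_auxR_integrand[OF \<open>x \<noteq> 0\<close>, of \<sigma> t] by (simp only: x_def)
qed

text \<open>On a diagonal strip \<open>Re x * Im x\<close> is quadratic in \<open>Im x\<close>,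
  while the other exponents grow at most linearly. \<open>M\<close> may depend on \<sigma>,
  \<open>t\<close> and \<open>P\<close>: the bound serves convergence and the contour shift, not the
  final estimate.\<close>

lemma norm_auxR_integrand_strip_le:
  fixes \<sigma> t P :: real
  assumes "\<sigma> \<le> 0"
  obtains M where "\<And>x. 0 < Re x - Im x \<Longrightarrow> Re x - Im x \<le> P \<Longrightarrow> 1 \<le> \<bar>Im x\<bar> \<Longrightarrow>
    norm (auxR_integrand (Complex \<sigma> t) x) \<le> M * exp (- 2 * (Im x)\<^sup>2)"
proof
  fix x :: complex
  assume x: "0 < Re x - Im x" "Re x - Im x \<le> P" "1 \<le> \<bar>Im x\<bar>"
  define w where "w = Im x"
  \<comment> \<open>The total coefficient of \<open>\<bar>w\<bar>\<close>: one part from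
    \<open>ln (norm x)\<close>, one from the offset \<open>Re x - Im x\<close>.\<close>
  define A where "A = - 2 * \<sigma> + 2 * pi * P"
  have "x \<noteq> 0" using x by auto
  have "ln (norm x) \<le> norm x" using \<open>x \<noteq> 0\<close> by (simp add: ln_bound)
  also have "norm x \<le> \<bar>Re x\<bar> + \<bar>Im x\<bar>" by (rule cmod_le)
  also have "\<dots> \<le> P + 2 * \<bar>w\<bar>" using x by (simp add: w_def)
  finally have 1: "- \<sigma> * ln (norm x) \<le> - \<sigma> * (P + 2 * \<bar>w\<bar>)"
    using assms by (intro mult_left_mono) auto
  have "\<bar>Im (Ln x)\<bar> \<le> pi" using \<open>x \<noteq> 0\<close> mpi_less_Im_Ln[of x] Im_Ln_le_pi[of x] by (auto simp: abs_le_iff)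
  then have "\<bar>t\<bar> * \<bar>Im (Ln x)\<bar> \<le> \<bar>t\<bar> * pi" by (intro mult_left_mono) auto
  then have 2: "t * Im (Ln x) \<le> \<bar>t\<bar> * pi" by (metis abs_mult abs_ge_self order_trans)
  have "- ((Re x - Im x) * w) \<le> P * \<bar>w\<bar>"
  proof -
    have "- ((Re x - Im x) * w) \<le> \<bar>Re x - Im x\<bar> * \<bar>w\<bar>" by (metis abs_mult abs_ge_minus_self)
    also have "\<dots> \<le> P * \<bar>w\<bar>" using x by (intro mult_right_mono) auto
    finally show ?thesis .
  qed
  then have "- (Re x * Im x) \<le> P * \<bar>w\<bar> - w\<^sup>2" by (simp add: w_def power2_eq_square algebra_simps)
  then have "2 * pi * - (Re x * Im x) \<le> 2 * pi * (P * \<bar>w\<bar> - w\<^sup>2)" by (intro mult_left_mono) auto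
  moreover have "2 * 3 * w\<^sup>2 \<le> 2 * pi * w\<^sup>2" using pi_gt3 by (intro mult_right_mono) auto
  ultimately have 3: "- 2 * pi * (Re x * Im x) \<le> 2 * pi * P * \<bar>w\<bar> - 6 * w\<^sup>2" by (simp add: algebra_simps)
  have "0 \<le> (\<bar>w\<bar> - A / 2)\<^sup>2" by simp
  then have "A * \<bar>w\<bar> \<le> w\<^sup>2 + A\<^sup>2 / 4" by (simp add: power2_eq_square algebra_simps)
  then have "- \<sigma> * ln (norm x) + t * Im (Ln x) - 2 * pi * (Re x * Im x) \<le> (- \<sigma> * P + \<bar>t\<bar> * pi + A\<^sup>2 / 4) + - 2 * (Im x)\<^sup>2"
  proof -
    assume "A * \<bar>w\<bar> \<le> w\<^sup>2 + A\<^sup>2 / 4"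
    moreover have "A * \<bar>w\<bar> = - 2 * \<sigma> * \<bar>w\<bar> + 2 * pi * P * \<bar>w\<bar>" by (simp add: A_def algebra_simps)
    moreover have "- \<sigma> * (P + 2 * \<bar>w\<bar>) = - \<sigma> * P - 2 * \<sigma> * \<bar>w\<bar>" by (simp add: algebra_simps)
    ultimately show ?thesis using 1 2 3 zero_le_power2[of w] unfolding w_def by linarith
  qed
  then have "exp (- \<sigma> * ln (norm x) + t * Im (Ln x) - 2 * pi * (Re x * Im x)) / norm (exp (of_real pi * \<i> * x) - exp (- of_real pi * \<i> * x))
      \<le> exp ((- \<sigma> * P + \<bar>t\<bar> * pi + A\<^sup>2 / 4) + - 2 * (Im x)\<^sup>2) / 1"
    using norm_denominator_ge_1[OF x(3)] by (intro frac_le) auto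
  then show "norm (auxR_integrand (Complex \<sigma> t) x)
      \<le> exp (- \<sigma> * P + \<bar>t\<bar> * pi + (- 2 * \<sigma> + 2 * pi * P)\<^sup>2 / 4) * exp (- 2 * (Im x)\<^sup>2)"
    unfolding norm_auxR_integrand[OF \<open>x \<noteq> 0\<close>] by (simp add: A_def flip: exp_add)
qed

section \<open>The partial sum of powers\<close>

lemma sum_powr_le:
  fixes k a :: real
  assumes "k > 0" "real N \<le> a"
  shows "(\<Sum>n=1..N. real n powr k) \<le> a powr k + a powr (k + 1) / (k + 1)"
proof -
  \<comment> \<open>The mean value theorem replaces a comparison with the integral. At
    \<open>n = 0\<close> the convention \<open>0 powr k = 0\<close> makes the left side
    vanish.\<close>
  have step: "real n powr k \<le> real (Suc n) powr (k + 1) / (k + 1) - real n powr (k + 1) / (k + 1)" for n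
  proof (cases "n = 0")
    case False
    have "\<exists>z. real n < z \<and> z < real (Suc n) \<and> real (Suc n) powr (k + 1) - real n powr (k + 1) = (real (Suc n) - real n) * ((k + 1) * z powr k)"
      by (rule MVT2) (use False assms in \<open>auto intro!: derivative_eq_intros\<close>)
    then obtain z where z: "real n < z" "real (Suc n) powr (k + 1) - real n powr (k + 1) = (k + 1) * z powr k" by auto
    have "real n powr k \<le> z powr k" using z assms by (intro powr_mono2) auto
    also have "\<dots> = (real (Suc n) powr (k + 1) - real n powr (k + 1)) / (k + 1)" using z assms by simp
    finally show ?thesis by (simp add: diff_divide_distrib)
  qed (use assms in simp)
  have "(\<Sum>n<N. real n powr k) \<le> real N powr (k + 1) / (k + 1)"
  proof (induction N)
    case (Suc N)
    then show ?case using step[of N] by simp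
  qed simp
  \<comment> \<open>The last term stays apart: including it in the telescoping sum would give
    \<open>N + 1\<close>, which may exceed \<open>a\<close>.\<close>
  moreover have "(\<Sum>n=1..N. real n powr k) \<le> (\<Sum>n<N. real n powr k) + real N powr k"
  proof -
    have "(\<Sum>n=1..N. real n powr k) \<le> (\<Sum>n\<in>{..N}. real n powr k)" by (intro sum_mono2) auto
    also have "\<dots> = (\<Sum>n<N. real n powr k) + real N powr k" by (simp add: lessThan_Suc_atMost[symmetric])
    finally show ?thesis .
  qed
  moreover have "real N powr k \<le> a powr k" "real N powr (k + 1) \<le> a powr (k + 1)"
    using assms by (auto intro: powr_mono2)
  then have "real N powr (k + 1) / (k + 1) \<le> a powr (k + 1) / (k + 1)" using assms by (intro divide_right_mono) auto
  ultimately show ?thesis using \<open>real N powr k \<le> a powr k\<close> by linarith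
qed

section \<open>The shifted integral\<close>

text \<open>Rotating by \<open>pi / 4\<close> turns the path of the auxiliary function into a vertical line, so that
  the contours become the axis-parallel rectangles of the library.\<close>

definition rotated_integrand :: "complex \<Rightarrow> complex \<Rightarrow> complex" where
  "rotated_integrand s z = auxR_integrand s (cis (- pi / 4) * z)"

lemma cis_minus_pi_4_times:
  "cis (- pi / 4) * z = Complex (sqrt 2 / 2 * (Re z + Im z)) (sqrt 2 / 2 * (Im z - Re z))"
  by (simp add: complex_eq_iff cos_45 sin_45 algebra_simps)

text \<open>Multiplying the path by \<open>cis (pi / 4)\<close> gives the line with real part
  \<open>sqrt 2 / 2 * c\<close>, traversed downwards as \<open>y = X - u\<close>; the reflection has
  Jacobian 1, and the direction factor of modulus 1 stays in front.\<close>

lemma auxR_eq_vertical_line_integral: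
  "auxR c s = cis (- 3 * pi / 4) * (\<integral>y. rotated_integrand s (Complex (sqrt 2 / 2 * c) y) \<partial>lborel)"
proof -
  let ?X = "sqrt 2 / 2 * c"
  have cs: "cos (3 * pi / 4) = - (sqrt 2 / 2)" "sin (3 * pi / 4) = sqrt 2 / 2"
    using cos_pi_minus[of "pi / 4"] sin_pi_minus[of "pi / 4"] by (simp_all add: cos_45 sin_45)
  have arg: "of_real c + of_real u * cis (- 3 * pi / 4) = cis (- pi / 4) * Complex ?X (?X + (- 1) * u)" for u
    unfolding cis_minus_pi_4_times by (simp add: complex_eq_iff cs) (simp add: field_simps)
  have "auxR c s = cis (- 3 * pi / 4) * (\<integral>u. rotated_integrand s (Complex ?X (?X + (- 1) * u)) \<partial>lborel)"
    unfolding auxR_def rotated_integrand_def arg by (simp add: mult.commute)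
  also have "(\<integral>u. rotated_integrand s (Complex ?X (?X + (- 1) * u)) \<partial>lborel) =
      (\<integral>y. rotated_integrand s (Complex ?X y) \<partial>lborel)"
    by (subst lborel_integral_real_affine[where c = "- 1" and t = ?X]) simp_all
  finally show ?thesis .
qed

lemma half_integer_notin_Ints: "real N + 1 / 2 \<notin> \<int>"
proof
  assume "real N + 1 / 2 \<in> \<int>"
  then obtain m where "real N + 1 / 2 = of_int m" by (auto elim: Ints_cases)
  then have "real_of_int (2 * int N + 1) = real_of_int (2 * m)" by simp
  then have "2 * int N + 1 = 2 * m" by (simp only: of_int_eq_iff)
  then show False by presburger
qed

lemma exp_pi_i_eq_imp_Ints:
  fixes x :: complex
  assumes "exp (of_real pi * \<i> * x) = exp (- of_real pi * \<i> * x)"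
  shows "x \<in> \<int>"
proof -
  obtain n :: int where "of_real pi * \<i> * x = - of_real pi * \<i> * x + (of_int (2 * n) * pi) * \<i>"
    using assms unfolding exp_eq by blast
  then have "(2 * of_real pi * \<i>) * x = (2 * of_real pi * \<i>) * of_int n" by (simp add: algebra_simps)
  then have "x = of_int n" by (subst (asm) mult_left_cancel) simp_all
  then show ?thesis by simp
qed

lemma auxR_integrand_holomorphic: "auxR_integrand s holomorphic_on {x. Im x < Re x} - \<int>"
proof -
  have "exp (of_real pi * \<i> * x) - exp (- of_real pi * \<i> * x) \<noteq> 0" if "x \<notin> \<int>" for x
    using exp_pi_i_eq_imp_Ints[of x] that by auto
  moreover have "x \<notin> \<real>\<^sub>\<le>\<^sub>0" if "Im x < Re x" for x using that by (auto simp: complex_nonpos_Reals_iff)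
  ultimately show ?thesis
    unfolding auxR_integrand_def by (intro holomorphic_intros) auto
qed

text \<open>The integer \<open>m\<close> is rotated to a point with real part
  \<open>sqrt 2 / 2 * m\<close>, so exactly \<open>1, \<dots>, N\<close> fall into the strip; its
  right edge is where the next pole lies.\<close>

lemma rotated_integrand_holomorphic:
  "rotated_integrand s holomorphic_on {z. 0 < Re z \<and> Re z < sqrt 2 / 2 * (real N + 1)} - (\<lambda>n. of_nat n * cis (pi / 4)) ` {1..N}"
proof -
  have "cis (- pi / 4) * z \<notin> \<int>"
    if z: "0 < Re z" "Re z < sqrt 2 / 2 * (real N + 1)" "z \<notin> (\<lambda>n. of_nat n * cis (pi / 4)) ` {1..N}" for z
  proof
    assume "cis (- pi / 4) * z \<in> \<int>"
    then obtain m where m: "cis (- pi / 4) * z = of_int m" by (auto elim: Ints_cases)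
    have "cis (pi / 4) * (cis (- pi / 4) * z) = z" by (simp add: cis_mult flip: mult.assoc)
    then have z_eq: "z = of_int m * cis (pi / 4)" unfolding m by (simp add: mult.commute)
    then have "Re z = sqrt 2 / 2 * of_int m" by (simp add: cos_45)
    then have "0 < sqrt 2 / 2 * real_of_int m" "sqrt 2 / 2 * of_int m < sqrt 2 / 2 * (real N + 1)"
      using z(1,2) by (simp_all only:)
    then have "0 < real_of_int m" "of_int m < real N + 1" by (simp_all add: zero_less_mult_iff)
    then have "0 < m" "m \<le> int N" by linarith+
    then have "z = of_nat (nat m) * cis (pi / 4)" "nat m \<in> {1..N}" using z_eq by auto
    then show False using z(3) by blast
  qed
  moreover have "Im (cis (- pi / 4) * z) < Re (cis (- pi / 4) * z)" if "0 < Re z" for z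
    unfolding cis_minus_pi_4_times using that by simp
  ultimately have "auxR_integrand s \<circ> (\<lambda>z. cis (- pi / 4) * z) holomorphic_on
      {z. 0 < Re z \<and> Re z < sqrt 2 / 2 * (real N + 1)} - (\<lambda>n. of_nat n * cis (pi / 4)) ` {1..N}"
    by (intro holomorphic_on_compose_gen[OF _ auxR_integrand_holomorphic] holomorphic_intros) auto
  then show ?thesis by (simp add: rotated_integrand_def[abs_def] o_def)
qed

text \<open>The margin \<open>\<beta> + 2\<close> makes \<open>\<bar>Im x\<bar> \<ge> 1\<close> for
  the rotated-back point \<open>x\<close>, so \<open>norm_auxR_integrand_strip_le\<close>
  applies.\<close>

lemma rotated_integrand_decay:
  fixes \<sigma> t \<beta> :: real
  assumes "\<sigma> \<le> 0"
  obtains M where "\<And>X y. 0 < X \<Longrightarrow> X \<le> \<beta> \<Longrightarrow> \<beta> + 2 \<le> \<bar>y\<bar> \<Longrightarrow>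
    norm (rotated_integrand (Complex \<sigma> t) (Complex X y)) \<le> M * exp (- y\<^sup>2 / 2)"
proof -
  obtain M where M: "\<And>x. 0 < Re x - Im x \<Longrightarrow> Re x - Im x \<le> sqrt 2 * \<beta> \<Longrightarrow> 1 \<le> \<bar>Im x\<bar> \<Longrightarrow>
    norm (auxR_integrand (Complex \<sigma> t) x) \<le> M * exp (- 2 * (Im x)\<^sup>2)"
    using norm_auxR_integrand_strip_le[OF assms] by blast
  show ?thesis
  proof
    fix X y :: real
    assume X: "0 < X" "X \<le> \<beta>" "\<beta> + 2 \<le> \<bar>y\<bar>"
    define x where "x = cis (- pi / 4) * Complex X y"
    have x: "Re x = sqrt 2 / 2 * (X + y)" "Im x = sqrt 2 / 2 * (y - X)"
      unfolding x_def cis_minus_pi_4_times by simp_all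
    have "Re x - Im x = sqrt 2 * X" unfolding x by (simp add: field_simps)
    moreover have "1 \<le> \<bar>Im x\<bar>"
    proof -
      have "1 * 2 \<le> sqrt 2 * \<bar>y - X\<bar>" using X by (intro mult_mono) auto
      then show ?thesis unfolding x by (simp add: abs_mult)
    qed
    ultimately have "norm (auxR_integrand (Complex \<sigma> t) x) \<le> M * exp (- 2 * (Im x)\<^sup>2)"
      using X by (intro M) auto
    also have "\<dots> \<le> \<bar>M\<bar> * exp (- 2 * (Im x)\<^sup>2)" by (intro mult_right_mono) auto
    also have "\<dots> \<le> \<bar>M\<bar> * exp (\<beta>\<^sup>2 - y\<^sup>2 / 2)"
    proof -
      have "2 * (Im x)\<^sup>2 = (y - X)\<^sup>2" by (simp add: x power_mult_distrib power_divide)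
      \<comment> \<open>This square completion trades half of the decay for a Gaussian centred at 0,
        whatever \<open>X\<close>.\<close>
      also have "\<dots> = (y - 2 * X)\<^sup>2 / 2 + y\<^sup>2 / 2 - X\<^sup>2" by (simp add: power2_eq_square field_simps)
      finally have "2 * (Im x)\<^sup>2 \<ge> y\<^sup>2 / 2 - X\<^sup>2" by simp
      moreover have "X\<^sup>2 \<le> \<beta>\<^sup>2" using X by (intro power_mono) auto
      ultimately show ?thesis by (intro mult_left_mono) auto
    qed
    also have "exp (\<beta>\<^sup>2 - y\<^sup>2 / 2) = exp (\<beta>\<^sup>2) * exp (- y\<^sup>2 / 2)" by (simp flip: exp_add)
    finally show "norm (rotated_integrand (Complex \<sigma> t) (Complex X y)) \<le> (\<bar>M\<bar> * exp (\<beta>\<^sup>2)) * exp (- y\<^sup>2 / 2)"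
      by (simp add: rotated_integrand_def x_def mult.assoc)
  qed
qed

lemma exp_minus_half_square_eq_normal_density: "exp (- (y - \<mu>)\<^sup>2 / 2) = sqrt (2 * pi) * normal_density \<mu> 1 y"
  by (simp add: normal_density_def)

lemma integrable_rotated_integrand:
  fixes \<sigma> t c :: real
  assumes "\<sigma> \<le> 0" "0 < c" "c \<notin> \<int>"
  shows "integrable lborel (\<lambda>y. rotated_integrand (Complex \<sigma> t) (Complex (sqrt 2 / 2 * c) y))"
proof -
  define X where "X = sqrt 2 / 2 * c"
  obtain M where M: "\<And>x y. 0 < x \<Longrightarrow> x \<le> X \<Longrightarrow> X + 2 \<le> \<bar>y\<bar> \<Longrightarrow>
    norm (rotated_integrand (Complex \<sigma> t) (Complex x y)) \<le> M * exp (- y\<^sup>2 / 2)"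
    using rotated_integrand_decay[OF assms(1)] by blast
  define x where "x = (\<lambda>y. cis (- pi / 4) * Complex X y)"
  have "x y \<in> {x. Im x < Re x} - \<int>" for y
  proof -
    \<comment> \<open>\<open>Re - Im\<close> is constantly \<open>c\<close> on the line, so an
      integer on it would have to be \<open>c\<close> itself.\<close>
    have diff: "Re (x y) - Im (x y) = c"
      unfolding x_def cis_minus_pi_4_times X_def by (simp add: field_simps)
    moreover have "x y \<notin> \<int>"
    proof
      assume "x y \<in> \<int>"
      then have "c \<in> \<int>" using diff by (auto elim!: Ints_cases)
      then show False using assms by simp
    qed
    ultimately show ?thesis using assms by auto
  qed
  moreover have "continuous_on UNIV x"
    unfolding x_def Complex_eq by (intro continuous_intros)
  ultimately have "continuous_on UNIV (\<lambda>y. auxR_integrand (Complex \<sigma> t) (x y))"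
    by (intro continuous_on_compose2[OF holomorphic_on_imp_continuous_on[OF auxR_integrand_holomorphic]]) auto
  then have "continuous_on UNIV (\<lambda>y. rotated_integrand (Complex \<sigma> t) (Complex X y))"
    by (simp add: rotated_integrand_def x_def)
  then have "integrable lborel (\<lambda>y. rotated_integrand (Complex \<sigma> t) (Complex X y))"
  proof (rule integrable_continuous_dominated_outside[where V = "X + 2" and g = "\<lambda>y. M * exp (- y\<^sup>2 / 2)"])
    show "integrable lborel (\<lambda>y. M * exp (- y\<^sup>2 / 2))"
      using exp_minus_half_square_eq_normal_density[where \<mu> = 0] by simp
  qed (use M[of X] assms in \<open>simp add: X_def\<close>)
  then show ?thesis by (simp add: X_def)
qed

section \<open>Residues, the contour shift and the integral on the new line\<close>

text \<open>A simple pole: the residue is numerator over derivative of the denominator. All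
  exponentials of multiples of \<open>pi * \<i>\<close> have modulus 1, leaving
  \<open>n powr (- \<sigma>)\<close> and the \<open>2 * pi\<close> from the derivative.\<close>

lemma norm_residue_rotated_integrand:
  fixes \<sigma> t :: real and n :: nat
  assumes "n > 0"
  shows "norm (residue (rotated_integrand (Complex \<sigma> t)) (of_nat n * cis (pi / 4))) = real n powr (- \<sigma>) / (2 * pi)"
proof -
  define \<omega> p where "\<omega> = cis (- pi / 4)" and "p = of_nat n * cis (pi / 4)"
  define f where "f = (\<lambda>z. exp (- Complex \<sigma> t * Ln (\<omega> * z)) * exp (of_real pi * \<i> * (\<omega> * z) ^ 2))"
  define g where "g = (\<lambda>z. exp (of_real pi * \<i> * (\<omega> * z)) - exp (- of_real pi * \<i> * (\<omega> * z)))"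
  define E where "E = exp (of_real pi * \<i> * of_nat n)"
  have \<omega>p: "\<omega> * p = of_nat n" by (simp add: \<omega>_def p_def cis_mult)
  have E: "exp (- of_real pi * \<i> * of_nat n) = E" "norm E = 1"
  proof -
    \<comment> \<open>The exponents differ by \<open>2 * pi * \<i> * n\<close>, so the two terms of
      the derivative of \<open>g\<close> add instead of cancelling.\<close>
    show "exp (- of_real pi * \<i> * of_nat n) = E"
      unfolding E_def exp_eq by (rule exI[of _ "- int n"]) (simp add: algebra_simps)
    show "norm E = 1" by (simp add: E_def norm_exp_eq_Re)
  qed
  have res: "residue (\<lambda>w. f w / g w) p = f p / (2 * of_real pi * \<i> * \<omega> * E)"
  proof (rule residue_simple_pole_deriv[where s = "{z. 0 < Re z}"])
    have "\<omega> * z \<notin> \<real>\<^sub>\<le>\<^sub>0" if "0 < Re z" for z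
      unfolding \<omega>_def cis_minus_pi_4_times using that by (auto simp: complex_nonpos_Reals_iff mult_le_0_iff)
    then show "f holomorphic_on {z. 0 < Re z}" unfolding f_def by (intro holomorphic_intros) auto
    show "g holomorphic_on {z. 0 < Re z}" unfolding g_def by (intro holomorphic_intros)
    show "open {z. 0 < Re z}" by (rule open_halfspace_Re_gt)
    show "connected {z. 0 < Re z}" by (intro convex_connected convex_halfspace_Re_gt)
    show "p \<in> {z. 0 < Re z}" using assms by (simp add: p_def cos_45)
    have "(g has_field_derivative of_real pi * \<i> * \<omega> * exp (of_real pi * \<i> * (\<omega> * p))
        + of_real pi * \<i> * \<omega> * exp (- of_real pi * \<i> * (\<omega> * p))) (at p)"
      unfolding g_def by (auto intro!: derivative_eq_intros simp: mult_ac)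
    moreover have "2 * of_real pi * \<i> * \<omega> * E = of_real pi * \<i> * \<omega> * E + of_real pi * \<i> * \<omega> * E"
      by simp
    ultimately show "(g has_field_derivative 2 * of_real pi * \<i> * \<omega> * E) (at p)"
      unfolding \<omega>p E(1) E_def[symmetric] by (simp only:)
    show "g p = 0" unfolding g_def \<omega>p E(1) E_def[symmetric] by simp
    show "f p \<noteq> 0" by (simp add: f_def)
    show "2 * of_real pi * \<i> * \<omega> * E \<noteq> 0" using E(2) by (auto simp: \<omega>_def)
  qed
  have "norm (f p) = exp (- \<sigma> * ln (real n))"
  proof -
    have "Ln (of_nat n) = of_real (ln (real n))" using assms by (metis Ln_of_real of_nat_0_less_iff of_real_of_nat_eq)
    then show ?thesis by (simp add: f_def \<omega>p norm_mult norm_exp_eq_Re power2_eq_square)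
  qed
  moreover have "rotated_integrand (Complex \<sigma> t) = (\<lambda>w. f w / g w)"
    by (simp add: rotated_integrand_def[abs_def] auxR_integrand_def f_def g_def \<omega>_def)
  ultimately show ?thesis
    using assms E(2) res by (simp add: p_def[symmetric] norm_divide norm_mult \<omega>_def powr_def)
qed

text \<open>The lines through \<open>c\<close> and \<open>N + 1 / 2\<close> enclose exactly the
  poles \<open>1, \<dots>, N\<close>. The factor \<open>2 * pi\<close> of the shift cancels that in
  the residues, and the triangle inequality discards all phases.\<close>

lemma norm_auxR_le_shifted:
  fixes \<sigma> t c :: real and N :: nat
  assumes "\<sigma> \<le> 0" "0 < c" "c < 1" "1 \<le> N"
  shows "norm (auxR c (Complex \<sigma> t)) \<le> norm (auxR (real N + 1 / 2) (Complex \<sigma> t)) + (\<Sum>n=1..N. real n powr (- \<sigma>))"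
proof -
  define s where "s = Complex \<sigma> t"
  define F where "F = rotated_integrand s"
  define a b where "a = sqrt 2 / 2 * c" and "b = sqrt 2 / 2 * (real N + 1 / 2)"
  define pts where "pts = (\<lambda>n. of_nat n * cis (pi / 4)) ` {1..N}"
  have not_Ints: "c \<notin> \<int>" "real N + 1 / 2 \<notin> \<int>"
  proof -
    show "c \<notin> \<int>"
    proof
      assume "c \<in> \<int>"
      then obtain m where "c = of_int m" by (auto elim: Ints_cases)
      then show False using assms by auto
    qed
    show "real N + 1 / 2 \<notin> \<int>" by (rule half_integer_notin_Ints)
  qed
  obtain M where M: "\<And>X y. 0 < X \<Longrightarrow> X \<le> b \<Longrightarrow> b + 2 \<le> \<bar>y\<bar> \<Longrightarrow> norm (F (Complex X y)) \<le> M * exp (- y\<^sup>2 / 2)"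
    unfolding F_def s_def using rotated_integrand_decay[OF assms(1)] by blast
  have "(\<integral>y. F (Complex b y) \<partial>lborel) - (\<integral>y. F (Complex a y) \<partial>lborel) = 2 * pi * (\<Sum>p\<in>pts. residue F p)"
  proof (rule vertical_line_integral_shift[where lo = 0 and hi = "sqrt 2 / 2 * (real N + 1)" and V = "b + 2" and B = "\<lambda>y. M * exp (- y\<^sup>2 / 2)"])
    show "0 < a" "a < b" "b < sqrt 2 / 2 * (real N + 1)" using assms by (auto simp: a_def b_def)
    then show "norm (F (Complex x y)) \<le> M * exp (- \<bar>y\<bar>\<^sup>2 / 2)" if "a \<le> x" "x \<le> b" "b + 2 \<le> \<bar>y\<bar>" for x y
      using M[of x y] that by simp
    show "finite pts" by (simp add: pts_def)
    show "pts \<subseteq> {z. a < Re z \<and> Re z < b}"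
    proof
      fix z assume "z \<in> pts"
      then obtain n where n: "n \<in> {1..N}" "z = of_nat n * cis (pi / 4)" by (auto simp: pts_def)
      then have "Re z = sqrt 2 / 2 * real n" by (simp add: cos_45)
      moreover have "c < real n" "real n < real N + 1 / 2" using n assms by auto
      ultimately show "z \<in> {z. a < Re z \<and> Re z < b}" by (simp add: a_def b_def)
    qed
    show "F holomorphic_on {z. 0 < Re z \<and> Re z < sqrt 2 / 2 * (real N + 1)} - pts"
      unfolding F_def pts_def by (rule rotated_integrand_holomorphic)
    show "integrable lborel (\<lambda>y. F (Complex a y))" "integrable lborel (\<lambda>y. F (Complex b y))"
      unfolding F_def s_def a_def b_def
      by (rule integrable_rotated_integrand; use assms not_Ints in simp)+
    show "((\<lambda>y. M * exp (- y\<^sup>2 / 2)) \<longlongrightarrow> 0) at_top" by real_asymp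
  qed
  then have "(\<integral>y. F (Complex a y) \<partial>lborel) = (\<integral>y. F (Complex b y) \<partial>lborel) - 2 * pi * (\<Sum>p\<in>pts. residue F p)"
    by (simp add: algebra_simps)
  then have "norm (\<integral>y. F (Complex a y) \<partial>lborel) \<le> norm (\<integral>y. F (Complex b y) \<partial>lborel) + norm (2 * pi * (\<Sum>p\<in>pts. residue F p))"
    by (metis norm_triangle_ineq4)
  also have "norm (2 * pi * (\<Sum>p\<in>pts. residue F p)) \<le> 2 * pi * (\<Sum>p\<in>pts. norm (residue F p))"
    by (simp add: norm_mult norm_sum)
  also have "(\<Sum>p\<in>pts. norm (residue F p)) = (\<Sum>n=1..N. norm (residue F (of_nat n * cis (pi / 4))))"
    unfolding pts_def by (rule sum.reindex_cong[OF _ refl]) (auto simp: inj_on_def)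
  also have "\<dots> = (\<Sum>n=1..N. real n powr (- \<sigma>) / (2 * pi))"
    unfolding F_def s_def by (intro sum.cong norm_residue_rotated_integrand) auto
  also have "2 * pi * \<dots> = (\<Sum>n=1..N. real n powr (- \<sigma>))" by (simp add: sum_distrib_left)
  finally show ?thesis
    unfolding auxR_eq_vertical_line_integral norm_mult by (simp add: F_def s_def a_def b_def)
qed

text \<open>In rotated coordinates the pointwise bound is \<open>K\<close> times a normal density
  centred at \<open>X\<close>, the height at which the line meets the rotated real axis; its
  integral is \<open>K\<close>.\<close>

lemma norm_auxR_half_integer_le:
  fixes \<sigma> t a :: real and N :: nat
  assumes "a \<ge> 1" "t = 2 * pi * a\<^sup>2" "0 < - \<sigma>" "- \<sigma> \<le> 3 * a" "N = nat \<lfloor>a\<rfloor>"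
  shows "norm (auxR (real N + 1 / 2) (Complex \<sigma> t)) \<le> a powr (- \<sigma>) * (exp 227 * sqrt (2 * pi))"
proof -
  define b X where "b = real N + 1 / 2" and "X = sqrt 2 / 2 * b"
  define K where "K = a powr (- \<sigma>) * (exp 227 * sqrt (2 * pi))"
  have "norm (rotated_integrand (Complex \<sigma> t) (Complex X y)) \<le> K * normal_density X 1 y" for y
  proof -
    define w where "w = sqrt 2 / 2 * (y - X)"
    have "cis (- pi / 4) * Complex X y = Complex (b + w) w"
      unfolding cis_minus_pi_4_times by (simp add: w_def X_def field_simps)
    then have "norm (rotated_integrand (Complex \<sigma> t) (Complex X y)) \<le> a powr (- \<sigma>) * exp (227 - w\<^sup>2)"
      using norm_auxR_integrand_half_integer_line_le[OF assms, of w] by (simp add: rotated_integrand_def b_def)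
    also have "w\<^sup>2 = (y - X)\<^sup>2 / 2" by (simp add: w_def power_mult_distrib power_divide)
    also have "exp (227 - (y - X)\<^sup>2 / 2) = exp 227 * exp (- (y - X)\<^sup>2 / 2)" by (simp flip: exp_add)
    finally show ?thesis unfolding exp_minus_half_square_eq_normal_density K_def by (simp only: mult_ac)
  qed
  moreover have "integrable lborel (\<lambda>y. rotated_integrand (Complex \<sigma> t) (Complex X y))"
  proof -
    have "b \<notin> \<int>" unfolding b_def by (rule half_integer_notin_Ints)
    moreover have "0 < b" by (simp add: b_def)
    ultimately show ?thesis unfolding X_def using assms(3) by (intro integrable_rotated_integrand) simp_all
  qed
  ultimately have "norm (\<integral>y. rotated_integrand (Complex \<sigma> t) (Complex X y) \<partial>lborel) \<le> (\<integral>y. K * normal_density X 1 y \<partial>lborel)"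
    by (intro Bochner_Integration.integral_norm_bound_integral) auto
  also have "\<dots> = K" by simp
  finally show ?thesis
    unfolding auxR_eq_vertical_line_integral norm_mult by (simp add: K_def X_def b_def)
qed

section \<open>Combination of the upper bound for \<open>auxR\<close> with the lower bound for
  \<open>chi\<close>\<close>

theorem corollary26:
  "\<exists>C T :: real. \<forall>c \<sigma> t :: real.
     0 < c \<and> c < 1 \<and> t > 0 \<and> t \<ge> T \<and> \<sigma> < 0 \<and> 1 < 1 - \<sigma> \<and> 1 - \<sigma> < t powr (1 / 2) \<longrightarrow>
       norm (auxR c (Complex \<sigma> t))
         \<le> norm (chi (Complex \<sigma> t)) * (C * ((t / (2 * pi)) powr (\<sigma> / 2) * inverse \<bar>\<sigma>\<bar>))"
proof (intro exI allI impI, elim conjE)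
  fix c \<sigma> t :: real
  \<comment> \<open>Fixes \<open>T = 8\<close>: since \<open>2 * pi < 8\<close>, this gives
    \<open>a \<ge> 1\<close> and hence \<open>N \<ge> 1\<close>.\<close>
  assume c: "0 < c" "c < 1" and t: "8 \<le> t" and \<sigma>: "\<sigma> < 0" "1 - \<sigma> < t powr (1 / 2)"
  define K where "K = exp 227 * sqrt (2 * pi)"
  define a k where "a = sqrt (t / (2 * pi))" and "k = - \<sigma>"
  define N where "N = nat \<lfloor>a\<rfloor>"
  have sqrt_t: "1 - \<sigma> < sqrt t" using \<sigma> t by (simp add: powr_half_sqrt)
  have "1 \<le> t / (2 * pi)" using t pi_less_4 by simp
  then have a: "1 \<le> a" "a\<^sup>2 = t / (2 * pi)" unfolding a_def using t by simp_all
  then have N: "1 \<le> N" "real N \<le> a" by (simp_all add: N_def le_nat_iff)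
  have t_eq: "t = 2 * pi * a\<^sup>2" using a by simp
  have k: "0 < k" "k \<le> 3 * a"
  proof -
    have "k \<le> sqrt t" using sqrt_t by (simp add: k_def)
    \<comment> \<open>The constant 3 is admissible because \<open>2 * pi < 9\<close>.\<close>
    also have "\<dots> \<le> sqrt ((3 * a)\<^sup>2)"
      unfolding t_eq power_mult_distrib using pi_less_4 by (intro real_sqrt_le_mono mult_right_mono) auto
    also have "\<dots> = 3 * a" using a(1) by (simp only: real_sqrt_abs)
    finally show "k \<le> 3 * a" .
  qed (use \<sigma> in \<open>simp add: k_def\<close>)
  have a2: "(t / (2 * pi)) powr r = a powr (2 * r)" for r
    unfolding a(2)[symmetric] using a(1) by (simp add: powr_powr flip: powr_numeral)
  have "norm (auxR c (Complex \<sigma> t)) \<le> a powr k * K + (\<Sum>n=1..N. real n powr k)"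
    using norm_auxR_le_shifted[of \<sigma> c N t] norm_auxR_half_integer_le[OF a(1) t_eq _ _ N_def, of \<sigma>] c \<sigma> k N
    by (simp add: K_def k_def)
  also have "\<dots> \<le> a powr k * K + (a powr k + a powr (k + 1) / (k + 1))"
    using sum_powr_le[OF k(1) N(2)] by simp
  also have "\<dots> \<le> a powr k * K + (a powr k + a powr (k + 1) / k)"
    using k by (intro add_left_mono divide_left_mono) auto
  also have "\<dots> = a powr k * (K + 1) + a powr (k + 1) / k" by (simp add: algebra_simps)
  \<comment> \<open>By \<open>k \<le> 3 * a\<close> the terms of order \<open>a powr k\<close> are
    absorbed into \<open>a powr (k + 1) / k\<close>.\<close>
  also have "\<dots> \<le> 3 * (a powr (k + 1) / k) * (K + 1) + a powr (k + 1) / k"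
  proof -
    have "a powr k * k \<le> a powr k * (3 * a)" using k by (intro mult_left_mono) auto
    then have "a powr k \<le> 3 * (a powr (k + 1) / k)" using k a(1) by (simp add: field_simps powr_add)
    moreover have "0 \<le> K + 1" by (simp add: K_def)
    ultimately show ?thesis by (intro add_right_mono mult_right_mono) auto
  qed
  also have "\<dots> = (3 * K + 4) * (a powr (k + 1) / k)" by (simp only: distrib_left distrib_right) simp
  also have "\<dots> = (exp (- 4 * pi) * (t / (2 * pi)) powr (1 / 2 - \<sigma>)) *
      (exp (4 * pi) * (3 * K + 4) * ((t / (2 * pi)) powr (\<sigma> / 2) * inverse \<bar>\<sigma>\<bar>))"
  proof -
    \<comment> \<open>The exponent \<open>1 - \<sigma>\<close> splits into
      \<open>1 - 2 * \<sigma>\<close>, supplied by the lower bound for \<open>chi\<close>, and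
      \<sigma>, which is the claimed power of \<open>t / (2 * pi)\<close>.\<close>
    have "k + 1 = 2 * (1 / 2 - \<sigma>) + 2 * (\<sigma> / 2)" by (simp add: k_def)
    then have powr_split: "a powr (k + 1) = a powr (2 * (1 / 2 - \<sigma>)) * a powr (2 * (\<sigma> / 2))"
      by (simp only: powr_add)
    have exp_cancel: "exp (- 4 * pi) * exp (4 * pi) = 1" by (simp flip: exp_add)
    have k_abs: "\<bar>\<sigma>\<bar> = k" using \<sigma> by (simp add: k_def)
    have "exp (- 4 * pi) * u * (exp (4 * pi) * (3 * K + 4) * (v * inverse k)) =
        exp (- 4 * pi) * exp (4 * pi) * ((3 * K + 4) * (u * v * inverse k))" for u v
      by (simp only: mult_ac)
    then show ?thesis
      unfolding a2 k_abs by (simp only: powr_split exp_cancel divide_inverse mult_1)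
  qed
  also have "\<dots> \<le> norm (chi (Complex \<sigma> t)) *
      (exp (4 * pi) * (3 * K + 4) * ((t / (2 * pi)) powr (\<sigma> / 2) * inverse \<bar>\<sigma>\<bar>))"
    using norm_chi_ge[of t \<sigma>] t \<sigma> sqrt_t by (intro mult_right_mono mult_nonneg_nonneg) (simp_all add: K_def)
  \<comment> \<open>\<open>K\<close> is spelled out because this line determines the witness
    \<open>C\<close>, which is chosen before \<open>K\<close> is introduced.\<close>
  finally show "norm (auxR c (Complex \<sigma> t)) \<le> norm (chi (Complex \<sigma> t)) *
      (exp (4 * pi) * (3 * (exp 227 * sqrt (2 * pi)) + 4) * ((t / (2 * pi)) powr (\<sigma> / 2) * inverse \<bar>\<sigma>\<bar>))"
    by (simp only: K_def)
qed

end
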